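(* Let $m\ge 4$ be even and let $k\in\{1,\dots,m-1\}$ be odd. Then $\gamma_{\mathrm{sdR}}(P_{m,k})=m$.
   Context: For $m\ge 3$ and $k\in\mathbb{Z}_m\setminus\{0\}$, the generalized Petersen graph $P_{m,k}$ is the simple graph with vertex set $\{u_i,v_i: i\in\mathbb{Z}_m\}$ and edge set $\{u_iu_{i+1},\ v_iv_{i+k},\ u_iv_i : i\in\mathbb{Z}_m\}$ (indices mod $m$). $N(u)$ is the open neighborhood, $N[u]=N(u)\cup\{u\}$; for $f:V\to\{-1,1,2,3\}$, $V_i=f^{-1}(i)$ and $f(S)=\sum_{s\in S}f(s)$. A signed double Roman domination function (SDRDF) is $f:V\to\{-1,1,2,3\}$ with: (1) every $u\in V_{-1}$ has a neighbor in $V_3$ or at least two distinct neighbors in $V_2$; (2) every $u\in V_1$ has a neighbor in $V_2\cup V_3$; (3) $f(N[u])\ge1$ for all $u$. $\gamma_{\mathrm{sdR}}(G)$ is the minimum of $f(V)$ over all SDRDFs on $G$.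
   Formalization: The case k = m/2 is excluded: there the inner vertices of the simple graph have degree 2 and the claimed value fails, for example γ_sdR(P_{6,3}) > 6. *)

theory Defs
  imports Main
begin

record 'a sgraph =
  verts :: "'a set"
  edges :: "'a set set"

definition simple_graph :: "'a sgraph \<Rightarrow> bool" where
  "simple_graph G \<longleftrightarrow> finite (verts G) \<and> (\<forall>e\<in>edges G. e \<subseteq> verts G \<and> card e = 2)"

definition nbhd :: "'a sgraph \<Rightarrow> 'a \<Rightarrow> 'a set" where
  "nbhd G u = {w \<in> verts G. {u, w} \<in> edges G}"

definition closed_nbhd :: "'a sgraph \<Rightarrow> 'a \<Rightarrow> 'a set" where
  "closed_nbhd G u = insert u (nbhd G u)"

text \<open>Labellings are total functions; only their values on the vertex set are constrained or used.\<close>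

definition sdrdf :: "'a sgraph \<Rightarrow> ('a \<Rightarrow> int) \<Rightarrow> bool" where
  "sdrdf G f \<longleftrightarrow>
     f ` verts G \<subseteq> {-1, 1, 2, 3} \<and>
     (\<forall>u\<in>verts G. f u = -1 \<longrightarrow>
        (\<exists>w\<in>nbhd G u. f w = 3) \<or>
        (\<exists>w\<in>nbhd G u. \<exists>w'\<in>nbhd G u. w \<noteq> w' \<and> f w = 2 \<and> f w' = 2)) \<and>
     (\<forall>u\<in>verts G. f u = 1 \<longrightarrow> (\<exists>w\<in>nbhd G u. f w = 2 \<or> f w = 3)) \<and>
     (\<forall>u\<in>verts G. sum f (closed_nbhd G u) \<ge> 1)"

definition sdrdf_weights :: "'a sgraph \<Rightarrow> int set" where
  "sdrdf_weights G = {sum f (verts G) |f. sdrdf G f}"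

definition gamma_sdR :: "'a sgraph \<Rightarrow> int" where
  "gamma_sdR G = Min (sdrdf_weights G)"

text \<open>\<^const>\<open>Min\<close> is only meaningful on finite nonempty sets.\<close>

lemma finite_sdrdf_weights:
  assumes "finite (verts G)"
  shows "finite (sdrdf_weights G)"
proof (rule finite_subset)
  show "sdrdf_weights G \<subseteq> {- int (card (verts G)) .. 3 * int (card (verts G))}"
  proof
    fix x assume "x \<in> sdrdf_weights G"
    then obtain f where x: "x = sum f (verts G)" and f: "sdrdf G f"
      by (auto simp: sdrdf_weights_def)
    have "f ` verts G \<subseteq> {-1, 1, 2, 3}"
      using f by (simp add: sdrdf_def)
    then have bounds: "-1 \<le> f v \<and> f v \<le> 3" if "v \<in> verts G" for v
      using that by fastforce
    have "of_nat (card (verts G)) * (-1) \<le> sum f (verts G)"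
      by (rule sum_bounded_below) (use bounds in auto)
    moreover have "sum f (verts G) \<le> of_nat (card (verts G)) * 3"
      by (rule sum_bounded_above) (use bounds in auto)
    ultimately show "x \<in> {- int (card (verts G)) .. 3 * int (card (verts G))}"
      using x by simp
  qed
qed simp

lemma sdrdf_weights_nonempty:
  assumes "finite (verts G)"
  shows "sdrdf_weights G \<noteq> {}"
proof -
  have "1 \<le> sum (\<lambda>_. 2 :: int) (closed_nbhd G u)" for u
  proof -
    have "finite (closed_nbhd G u)" and "u \<in> closed_nbhd G u"
      using assms by (simp_all add: closed_nbhd_def nbhd_def)
    then have "card (closed_nbhd G u) > 0"
      by (auto simp only: card_gt_0_iff)
    then show ?thesis
      by simp
  qed
  then have "sdrdf G (\<lambda>_. 2)"
    unfolding sdrdf_def by (simp add: image_subset_iff)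
  then show ?thesis
    unfolding sdrdf_weights_def by blast
qed

text \<open>The residues modulo \<open>m\<close> are represented by \<open>0, \<dots>, m - 1\<close>.\<close>

datatype pvertex = U nat | V nat

definition petersen :: "nat \<Rightarrow> nat \<Rightarrow> pvertex sgraph" where
  "petersen m k =
     \<lparr> verts = U ` {0..<m} \<union> V ` {0..<m},
       edges = (\<Union>i\<in>{0..<m}. { {U i, U ((i + 1) mod m)},
                               {V i, V ((i + k) mod m)},
                               {U i, V i} }) \<rparr>"

lemma mod_shift_neq:
  fixes i j m :: nat
  assumes "i < m" "0 < j" "j < m"
  shows "(i + j) mod m \<noteq> i"
  using assms by (cases "i + j < m") (simp_all add: le_mod_geq)

lemma simple_graph_petersen:
  assumes "m \<ge> 3" "0 < k" "k < m"
  shows "simple_graph (petersen m k)"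
proof -
  have "(i + 1) mod m \<noteq> i" "(i + k) mod m \<noteq> i" if "i < m" for i
    using assms that by (intro mod_shift_neq; simp)+
  then have two: "card {U i, U ((i + 1) mod m)} = 2" "card {V i, V ((i + k) mod m)} = 2"
      "card {U i, V i} = 2" if "i < m" for i
    using that by (metis card_2_iff pvertex.inject(1), metis card_2_iff pvertex.inject(2), simp)
  show ?thesis
    unfolding simple_graph_def
  proof (intro conjI ballI)
    show "finite (verts (petersen m k))"
      by (simp add: petersen_def)
  next
    fix e assume "e \<in> edges (petersen m k)"
    then obtain i where i: "i < m"
      and e: "e = {U i, U ((i + 1) mod m)} \<or> e = {V i, V ((i + k) mod m)} \<or> e = {U i, V i}"
      unfolding petersen_def by auto
    show "e \<subseteq> verts (petersen m k)"
      using e i by (auto simp: petersen_def)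
    show "card e = 2"
      using e two[OF i] by metis
  qed
qed

lemma petersen_edge_iff:
  "{U i, U j} \<in> edges (petersen m k) \<longleftrightarrow>
     i < m \<and> j < m \<and> (j = (i + 1) mod m \<or> i = (j + 1) mod m)"
  "{V i, V j} \<in> edges (petersen m k) \<longleftrightarrow>
     i < m \<and> j < m \<and> (j = (i + k) mod m \<or> i = (j + k) mod m)"
  "{U i, V j} \<in> edges (petersen m k) \<longleftrightarrow> i < m \<and> i = j"
  "{V i, U j} \<in> edges (petersen m k) \<longleftrightarrow> i < m \<and> i = j"
  by (auto simp: petersen_def doubleton_eq_iff)

text \<open>If \<open>2 * k = m\<close>, then \<open>{V i, V (i + k)}\<close> and \<open>{V (i + k), V i}\<close> are the same edge and the
  inner vertices have degree 2. For even \<open>m\<close> and odd \<open>k\<close> the value \<open>m\<close> can fail in this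
  degenerate case, and it does for \<open>m = 6\<close>, \<open>k = 3\<close>.\<close>

lemma weight_6_3_aux:
  fixes a0 a1 a2 a3 a4 a5 b0 b1 b2 b3 b4 b5 :: int
  assumes "a0 = -1 \<or> a0 = 1 \<or> a0 = 2 \<or> a0 = 3"
    and "a1 = -1 \<or> a1 = 1 \<or> a1 = 2 \<or> a1 = 3"
    and "a2 = -1 \<or> a2 = 1 \<or> a2 = 2 \<or> a2 = 3"
    and "a3 = -1 \<or> a3 = 1 \<or> a3 = 2 \<or> a3 = 3"
    and "a4 = -1 \<or> a4 = 1 \<or> a4 = 2 \<or> a4 = 3"
    and "a5 = -1 \<or> a5 = 1 \<or> a5 = 2 \<or> a5 = 3"
    and "b0 = -1 \<or> b0 = 1 \<or> b0 = 2 \<or> b0 = 3"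
    and "b1 = -1 \<or> b1 = 1 \<or> b1 = 2 \<or> b1 = 3"
    and "b2 = -1 \<or> b2 = 1 \<or> b2 = 2 \<or> b2 = 3"
    and "b3 = -1 \<or> b3 = 1 \<or> b3 = 2 \<or> b3 = 3"
    and "b4 = -1 \<or> b4 = 1 \<or> b4 = 2 \<or> b4 = 3"
    and "b5 = -1 \<or> b5 = 1 \<or> b5 = 2 \<or> b5 = 3"
    and "a0 + a1 + a5 + b0 \<ge> 1"
    and "a0 = -1 \<longrightarrow> a1=3 \<or> a5=3 \<or> b0=3 \<or> (a1=2 \<and> a5=2) \<or> (a1=2 \<and> b0=2) \<or> (a5=2 \<and> b0=2)"
    and "a0 = 1 \<longrightarrow> a1=2 \<or> a1=3 \<or> a5=2 \<or> a5=3 \<or> b0=2 \<or> b0=3"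
    and "a1 + a0 + a2 + b1 \<ge> 1"
    and "a1 = -1 \<longrightarrow> a0=3 \<or> a2=3 \<or> b1=3 \<or> (a0=2 \<and> a2=2) \<or> (a0=2 \<and> b1=2) \<or> (a2=2 \<and> b1=2)"
    and "a1 = 1 \<longrightarrow> a0=2 \<or> a0=3 \<or> a2=2 \<or> a2=3 \<or> b1=2 \<or> b1=3"
    and "a2 + a1 + a3 + b2 \<ge> 1"
    and "a2 = -1 \<longrightarrow> a1=3 \<or> a3=3 \<or> b2=3 \<or> (a1=2 \<and> a3=2) \<or> (a1=2 \<and> b2=2) \<or> (a3=2 \<and> b2=2)"
    and "a2 = 1 \<longrightarrow> a1=2 \<or> a1=3 \<or> a3=2 \<or> a3=3 \<or> b2=2 \<or> b2=3"
    and "a3 + a2 + a4 + b3 \<ge> 1"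
    and "a3 = -1 \<longrightarrow> a2=3 \<or> a4=3 \<or> b3=3 \<or> (a2=2 \<and> a4=2) \<or> (a2=2 \<and> b3=2) \<or> (a4=2 \<and> b3=2)"
    and "a3 = 1 \<longrightarrow> a2=2 \<or> a2=3 \<or> a4=2 \<or> a4=3 \<or> b3=2 \<or> b3=3"
    and "a4 + a3 + a5 + b4 \<ge> 1"
    and "a4 = -1 \<longrightarrow> a3=3 \<or> a5=3 \<or> b4=3 \<or> (a3=2 \<and> a5=2) \<or> (a3=2 \<and> b4=2) \<or> (a5=2 \<and> b4=2)"
    and "a4 = 1 \<longrightarrow> a3=2 \<or> a3=3 \<or> a5=2 \<or> a5=3 \<or> b4=2 \<or> b4=3"
    and "a5 + a0 + a4 + b5 \<ge> 1"
    and "a5 = -1 \<longrightarrow> a0=3 \<or> a4=3 \<or> b5=3 \<or> (a0=2 \<and> a4=2) \<or> (a0=2 \<and> b5=2) \<or> (a4=2 \<and> b5=2)"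
    and "a5 = 1 \<longrightarrow> a0=2 \<or> a0=3 \<or> a4=2 \<or> a4=3 \<or> b5=2 \<or> b5=3"
    and "b0 + a0 + b3 \<ge> 1"
    and "b0 = -1 \<longrightarrow> a0=3 \<or> b3=3 \<or> (a0=2 \<and> b3=2)"
    and "b0 = 1 \<longrightarrow> a0=2 \<or> a0=3 \<or> b3=2 \<or> b3=3"
    and "b1 + a1 + b4 \<ge> 1"
    and "b1 = -1 \<longrightarrow> a1=3 \<or> b4=3 \<or> (a1=2 \<and> b4=2)"
    and "b1 = 1 \<longrightarrow> a1=2 \<or> a1=3 \<or> b4=2 \<or> b4=3"
    and "b2 + a2 + b5 \<ge> 1"
    and "b2 = -1 \<longrightarrow> a2=3 \<or> b5=3 \<or> (a2=2 \<and> b5=2)"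
    and "b2 = 1 \<longrightarrow> a2=2 \<or> a2=3 \<or> b5=2 \<or> b5=3"
    and "b3 + a3 + b0 \<ge> 1"
    and "b3 = -1 \<longrightarrow> a3=3 \<or> b0=3 \<or> (a3=2 \<and> b0=2)"
    and "b3 = 1 \<longrightarrow> a3=2 \<or> a3=3 \<or> b0=2 \<or> b0=3"
    and "b4 + a4 + b1 \<ge> 1"
    and "b4 = -1 \<longrightarrow> a4=3 \<or> b1=3 \<or> (a4=2 \<and> b1=2)"
    and "b4 = 1 \<longrightarrow> a4=2 \<or> a4=3 \<or> b1=2 \<or> b1=3"
    and "b5 + a5 + b2 \<ge> 1"
    and "b5 = -1 \<longrightarrow> a5=3 \<or> b2=3 \<or> (a5=2 \<and> b2=2)"
    and "b5 = 1 \<longrightarrow> a5=2 \<or> a5=3 \<or> b2=2 \<or> b2=3"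
    and "a0 + a1 + a2 + a3 + a4 + a5 + b0 + b1 + b2 + b3 + b4 + b5 \<le> 6"
  shows False
  using assms using [[smt_timeout=100]] by (smt (verit))

lemma sdrdf_at_degree_3:
  assumes "sdrdf G f" "u \<in> verts G" "nbhd G u = {a, b, c}" "distinct [u, a, b, c]"
  shows "f u + f a + f b + f c \<ge> 1"
    and "f u = -1 \<longrightarrow> f a = 3 \<or> f b = 3 \<or> f c = 3 \<or>
           (f a = 2 \<and> f b = 2) \<or> (f a = 2 \<and> f c = 2) \<or> (f b = 2 \<and> f c = 2)"
    and "f u = 1 \<longrightarrow> f a = 2 \<or> f a = 3 \<or> f b = 2 \<or> f b = 3 \<or> f c = 2 \<or> f c = 3"
proof -
  have "sum f (closed_nbhd G u) \<ge> 1"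
    using assms(1,2) unfolding sdrdf_def by blast
  then show "f u + f a + f b + f c \<ge> 1"
    using assms(3,4) by (simp add: closed_nbhd_def)
qed (use assms(1-3) in \<open>unfold sdrdf_def, (metis insert_iff empty_iff)+\<close>)

lemma sdrdf_at_degree_2:
  assumes "sdrdf G f" "u \<in> verts G" "nbhd G u = {a, b}" "distinct [u, a, b]"
  shows "f u + f a + f b \<ge> 1"
    and "f u = -1 \<longrightarrow> f a = 3 \<or> f b = 3 \<or> (f a = 2 \<and> f b = 2)"
    and "f u = 1 \<longrightarrow> f a = 2 \<or> f a = 3 \<or> f b = 2 \<or> f b = 3"
proof -
  have "sum f (closed_nbhd G u) \<ge> 1"
    using assms(1,2) unfolding sdrdf_def by blast
  then show "f u + f a + f b \<ge> 1"
    using assms(3,4) by (simp add: closed_nbhd_def)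
qed (use assms(1-3) in \<open>unfold sdrdf_def, (metis insert_iff empty_iff)+\<close>)

lemma gamma_sdR_petersen_6_3: "gamma_sdR (petersen 6 3) > 6"
proof -
  let ?G = "petersen 6 3"
  have six: "{0..<6::nat} = {0, 1, 2, 3, 4, 5}"
    by auto
  have vs: "verts ?G = {U 0, U 1, U 2, U 3, U 4, U 5, V 0, V 1, V 2, V 3, V 4, V 5}"
    unfolding petersen_def six by auto
  have no_loop: "{x} \<notin> edges ?G" for x
  proof
    assume "{x} \<in> edges ?G"
    then have "card {x} = 2"
      using simple_graph_petersen[of 6 3] unfolding simple_graph_def by fastforce
    then show False
      by simp
  qed
  have filter_insert: "{w \<in> insert a A. P w} = (if P a then insert a {w \<in> A. P w} else {w \<in> A. P w})"
    for a :: pvertex and A P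
    by auto
  have nb: "nbhd ?G (U 0) = {U 1, U 5, V 0}"
      "nbhd ?G (U 1) = {U 0, U 2, V 1}"
      "nbhd ?G (U 2) = {U 1, U 3, V 2}"
      "nbhd ?G (U 3) = {U 2, U 4, V 3}"
      "nbhd ?G (U 4) = {U 3, U 5, V 4}"
      "nbhd ?G (U 5) = {U 0, U 4, V 5}"
      "nbhd ?G (V 0) = {U 0, V 3}"
      "nbhd ?G (V 1) = {U 1, V 4}"
      "nbhd ?G (V 2) = {U 2, V 5}"
      "nbhd ?G (V 3) = {U 3, V 0}"
      "nbhd ?G (V 4) = {U 4, V 1}"
      "nbhd ?G (V 5) = {U 5, V 2}"
    unfolding nbhd_def vs filter_insert
    by (simp_all add: petersen_edge_iff no_loop insert_commute)
  have "sum f (verts ?G) > 6" if f: "sdrdf ?G f" for f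
  proof (rule ccontr)
    assume "\<not> ?thesis"
    then have tot: "sum f (verts ?G) \<le> 6"
      by simp
    have vals: "f x = -1 \<or> f x = 1 \<or> f x = 2 \<or> f x = 3" if "x \<in> verts ?G" for x
      using f that unfolding sdrdf_def by blast
    have mem: "U 0 \<in> verts ?G" "U 1 \<in> verts ?G" "U 2 \<in> verts ?G" "U 3 \<in> verts ?G" "U 4 \<in> verts ?G" "U 5 \<in> verts ?G"
      "V 0 \<in> verts ?G" "V 1 \<in> verts ?G" "V 2 \<in> verts ?G" "V 3 \<in> verts ?G" "V 4 \<in> verts ?G" "V 5 \<in> verts ?G"
      by (simp_all add: vs)
    have dist: "distinct [U 0, U 1, U 5, V 0]"
      "distinct [U 1, U 0, U 2, V 1]"
      "distinct [U 2, U 1, U 3, V 2]"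
      "distinct [U 3, U 2, U 4, V 3]"
      "distinct [U 4, U 3, U 5, V 4]"
      "distinct [U 5, U 0, U 4, V 5]"
      "distinct [V 0, U 0, V 3]"
      "distinct [V 1, U 1, V 4]"
      "distinct [V 2, U 2, V 5]"
      "distinct [V 3, U 3, V 0]"
      "distinct [V 4, U 4, V 1]"
      "distinct [V 5, U 5, V 2]"
      by simp_all
    note c0 = sdrdf_at_degree_3[OF f mem(1) nb(1) dist(1)]
    note c1 = sdrdf_at_degree_3[OF f mem(2) nb(2) dist(2)]
    note c2 = sdrdf_at_degree_3[OF f mem(3) nb(3) dist(3)]
    note c3 = sdrdf_at_degree_3[OF f mem(4) nb(4) dist(4)]
    note c4 = sdrdf_at_degree_3[OF f mem(5) nb(5) dist(5)]
    note c5 = sdrdf_at_degree_3[OF f mem(6) nb(6) dist(6)]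
    note c6 = sdrdf_at_degree_2[OF f mem(7) nb(7) dist(7)]
    note c7 = sdrdf_at_degree_2[OF f mem(8) nb(8) dist(8)]
    note c8 = sdrdf_at_degree_2[OF f mem(9) nb(9) dist(9)]
    note c9 = sdrdf_at_degree_2[OF f mem(10) nb(10) dist(10)]
    note c10 = sdrdf_at_degree_2[OF f mem(11) nb(11) dist(11)]
    note c11 = sdrdf_at_degree_2[OF f mem(12) nb(12) dist(12)]
    have total: "f (U 0) + f (U 1) + f (U 2) + f (U 3) + f (U 4) + f (U 5)
        + f (V 0) + f (V 1) + f (V 2) + f (V 3) + f (V 4) + f (V 5) \<le> 6"
      using tot by (simp add: vs)
    show False
      by (rule weight_6_3_aux[OF
            vals[OF mem(1)] vals[OF mem(2)] vals[OF mem(3)] vals[OF mem(4)] vals[OF mem(5)] vals[OF mem(6)] vals[OF mem(7)] vals[OF mem(8)] vals[OF mem(9)] vals[OF mem(10)] vals[OF mem(11)] vals[OF mem(12)]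
            c0(1) c0(2) c0(3)
            c1(1) c1(2) c1(3)
            c2(1) c2(2) c2(3)
            c3(1) c3(2) c3(3)
            c4(1) c4(2) c4(3)
            c5(1) c5(2) c5(3)
            c6(1) c6(2) c6(3)
            c7(1) c7(2) c7(3)
            c8(1) c8(2) c8(3)
            c9(1) c9(2) c9(3)
            c10(1) c10(2) c10(3)
            c11(1) c11(2) c11(3) total])
  qed
  then have "\<forall>w\<in>sdrdf_weights ?G. 6 < w"
    by (auto simp: sdrdf_weights_def)
  moreover have "finite (verts ?G)"
    by (simp add: vs)
  ultimately show ?thesis
    unfolding gamma_sdR_def
    by (simp add: finite_sdrdf_weights sdrdf_weights_nonempty)
qed

end

theory Submission
  imports Defs
begin

text \<open>Lower bound, valid in every cubic graph: a vertex of positive label \<open>c\<close> has at most two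
  neighbours labelled \<open>-1\<close> and can send each of them \<open>(2 * c - 1) / 2\<close>; the domination conditions
  guarantee that each vertex labelled \<open>-1\<close> then receives at least \<open>3\<close>. Summing,
  \<open>2 * f u - 1\<close> has nonnegative total. Upper bound: label \<open>U i\<close> and \<open>V i\<close> by \<open>2\<close> for even \<open>i\<close>
  and by \<open>-1\<close> for odd \<open>i\<close>; all edges but the spokes change the parity of the index.\<close>

section \<open>Lower bound for cubic graphs by discharging\<close>

lemma nbhd_sym:
  assumes "u \<in> verts G" "w \<in> nbhd G u"
  shows "u \<in> nbhd G w"
  using assms by (simp add: nbhd_def insert_commute)

lemma simple_graph_nbhd_irrefl:
  assumes "simple_graph G"
  shows "u \<notin> nbhd G u"
  using assms by (auto simp: simple_graph_def nbhd_def)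

lemma cubic_nbhdE:
  assumes "simple_graph G" "card (nbhd G u) = 3"
  obtains a b c where "nbhd G u = {a, b, c}" "distinct [u, a, b, c]"
proof -
  obtain a b c where "nbhd G u = {a, b, c}" "a \<noteq> b" "a \<noteq> c" "b \<noteq> c"
    using assms(2) by (auto simp: card_3_iff)
  with simple_graph_nbhd_irrefl[OF assms(1), of u] that show ?thesis
    by auto
qed

lemma sdrdf_weight_cubic_ge:
  assumes G: "simple_graph G"
    and cubic: "\<And>u. u \<in> verts G \<Longrightarrow> card (nbhd G u) = 3"
    and f: "sdrdf G f"
  shows "2 * sum f (verts G) \<ge> int (card (verts G))"
proof -
  define N where "N = {u \<in> verts G. f u = -1}"
  define P where "P = {u \<in> verts G. f u \<noteq> -1}"
  \<comment> \<open>\<open>g\<close> is twice the amount sent along each edge, so all counts stay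
    integral: the required 3 becomes 6.\<close>
  define g where "g w = 2 * f w - 1" for w
  have fin: "finite (verts G)"
    using G by (simp add: simple_graph_def)
  then have finNP: "finite N" "finite P"
    by (simp_all add: N_def P_def)
  have vals: "f w = -1 \<or> f w = 1 \<or> f w = 2 \<or> f w = 3" if "w \<in> verts G" for w
    using f that unfolding sdrdf_def by blast
  have receive: "6 \<le> sum g {w \<in> P. w \<in> nbhd G u}" if u: "u \<in> N" for u
  proof -
    have uV: "u \<in> verts G" and fu: "f u = -1"
      using u by (simp_all add: N_def)
    obtain a b c where nb: "nbhd G u = {a, b, c}" and d: "distinct [u, a, b, c]"
      using cubic_nbhdE[OF G cubic[OF uV]] .
    have sub: "a \<in> verts G" "b \<in> verts G" "c \<in> verts G"
      using nb by (auto simp: nbhd_def)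
    have "{w \<in> P. w \<in> nbhd G u} = {w \<in> {a, b, c}. f w \<noteq> -1}"
      using sub unfolding nb P_def by auto
    then have "sum g {w \<in> P. w \<in> nbhd G u} = (\<Sum>w\<in>{a, b, c}. if f w \<noteq> -1 then g w else 0)"
      by (simp only: sum.inter_filter finite.intros)
    also have "\<dots> = (if f a \<noteq> -1 then g a else 0) + (if f b \<noteq> -1 then g b else 0)
        + (if f c \<noteq> -1 then g c else 0)"
      using d by simp
    \<comment> \<open>Two labels 2 give 3 + 3. A label 3 gives only 5, but the three labels sum to
      at least 2, so a second one is positive and adds at least 1.\<close>
    also have "\<dots> \<ge> 6"
    proof -
      have "f a + f b + f c \<ge> 2"
        and "f a = 3 \<or> f b = 3 \<or> f c = 3 \<or>
          (f a = 2 \<and> f b = 2) \<or> (f a = 2 \<and> f c = 2) \<or> (f b = 2 \<and> f c = 2)"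
        using sdrdf_at_degree_3(1,2)[OF f uV nb d] fu by simp_all
      then show ?thesis
        using vals[OF sub(1)] vals[OF sub(2)] vals[OF sub(3)]
        by (elim disjE conjE) (simp_all add: g_def)
    qed
    finally show ?thesis .
  qed
  have send: "int (card {u \<in> N. w \<in> nbhd G u}) \<le> 2" if w: "w \<in> P" for w
  proof -
    have wV: "w \<in> verts G" and fw: "f w \<noteq> -1"
      using w by (simp_all add: P_def)
    obtain a b c where nb: "nbhd G w = {a, b, c}" and d: "distinct [w, a, b, c]"
      using cubic_nbhdE[OF G cubic[OF wV]] .
    have "{u \<in> N. w \<in> nbhd G u} \<subseteq> {u \<in> {a, b, c}. f u = -1}"
      using nbhd_sym[of _ G w] nb by (auto simp: N_def)
    \<comment> \<open>Three neighbours labelled -1 would leave a closed neighbourhood sum of at most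
      3 - 3 = 0.\<close>
    moreover have "\<not> (f a = -1 \<and> f b = -1 \<and> f c = -1)"
      using sdrdf_at_degree_3(1)[OF f wV nb d] vals[OF wV] by auto
    ultimately have "{u \<in> N. w \<in> nbhd G u} \<subset> {a, b, c}"
      by auto
    then have "card {u \<in> N. w \<in> nbhd G u} < card {a, b, c}"
      by (intro psubset_card_mono) auto
    then show ?thesis
      using d by simp
  qed
  have "6 * int (card N) = (\<Sum>u\<in>N. 6)"
    by simp
  also have "\<dots> \<le> (\<Sum>u\<in>N. sum g {w \<in> P. w \<in> nbhd G u})"
    by (intro sum_mono receive)
  \<comment> \<open>Double counting of the edges between \<open>N\<close> and
    \<open>P\<close>.\<close>
  also have "\<dots> = (\<Sum>w\<in>P. \<Sum>u | u \<in> N \<and> w \<in> nbhd G u. g w)"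
    by (rule sum.swap_restrict[OF finNP])
  also have "\<dots> = (\<Sum>w\<in>P. int (card {u \<in> N. w \<in> nbhd G u}) * g w)"
    by simp
  also have "\<dots> \<le> (\<Sum>w\<in>P. 2 * g w)"
  proof (intro sum_mono mult_right_mono send)
    show "0 \<le> g w" if "w \<in> P" for w
      using that vals[of w] by (auto simp: P_def g_def)
  qed
  finally have "3 * int (card N) \<le> sum g P"
    by (simp flip: sum_distrib_left)
  moreover have "sum g N = - 3 * int (card N)"
    by (simp add: g_def N_def)
  moreover have "sum g (verts G) = sum g N + sum g P"
  proof -
    have "verts G = N \<union> P" "N \<inter> P = {}"
      by (auto simp: N_def P_def)
    then show ?thesis
      using sum.union_disjoint[OF finNP, of g] by simp
  qed
  moreover have "sum g (verts G) = 2 * sum f (verts G) - int (card (verts G))"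
    by (simp add: g_def sum_subtractf sum_distrib_left)
  ultimately show ?thesis
    by linarith
qed

section \<open>Neighbourhoods in the generalized Petersen graph\<close>

lemma eq_add_mod_iff:
  fixes i j k m :: nat
  assumes "i < m" "j < m" "k < m"
  shows "i = (j + k) mod m \<longleftrightarrow> j = (i + (m - k)) mod m"
  using assms by (auto simp: mod_if)

text \<open>Shifts by \<open>k\<close> and by \<open>-k\<close>, the latter written as
  \<open>m - k\<close> to stay in the naturals, agree only if \<open>m\<close> divides
  \<open>2 * k\<close>; as \<open>0 < 2 * k < 2 * m\<close>, this forces
  \<open>2 * k = m\<close>.\<close>

lemma add_mod_neq_sub_mod:
  fixes i k m :: nat
  assumes "i < m" "0 < k" "k < m" "2 * k \<noteq> m"
  shows "(i + k) mod m \<noteq> (i + (m - k)) mod m"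
  using assms by (auto simp: mod_if)

lemma verts_petersen: "verts (petersen m k) = U ` {0..<m} \<union> V ` {0..<m}"
  by (simp add: petersen_def)

lemma verts_petersen_iff:
  "U i \<in> verts (petersen m k) \<longleftrightarrow> i < m"
  "V i \<in> verts (petersen m k) \<longleftrightarrow> i < m"
  by (auto simp: verts_petersen)

lemma petersen_vertexE:
  assumes "u \<in> verts (petersen m k)"
  obtains i where "i < m" "u = U i \<or> u = V i"
  using assms unfolding verts_petersen by fastforce

lemma nbhd_petersen_U:
  assumes "1 < m" "i < m"
  shows "nbhd (petersen m k) (U i) = {U ((i + 1) mod m), U ((i + (m - 1)) mod m), V i}"
proof -
  have "j < m \<and> (j = (i + 1) mod m \<or> i = (j + 1) mod m) \<longleftrightarrow>
      j = (i + 1) mod m \<or> j = (i + (m - 1)) mod m" for j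
    using assms eq_add_mod_iff[of i m j 1] by (metis mod_less_divisor gr_implies_not0 gr0I)
  then have "w \<in> nbhd (petersen m k) (U i) \<longleftrightarrow>
      w \<in> {U ((i + 1) mod m), U ((i + (m - 1)) mod m), V i}" for w
    using assms unfolding nbhd_def
    by (cases w) (simp_all add: verts_petersen_iff petersen_edge_iff, blast+)
  then show ?thesis
    by blast
qed

lemma nbhd_petersen_V:
  assumes "i < m" "k < m"
  shows "nbhd (petersen m k) (V i) = {V ((i + k) mod m), V ((i + (m - k)) mod m), U i}"
proof -
  have "j < m \<and> (j = (i + k) mod m \<or> i = (j + k) mod m) \<longleftrightarrow>
      j = (i + k) mod m \<or> j = (i + (m - k)) mod m" for j
    using assms eq_add_mod_iff[of i m j k] by (metis mod_less_divisor gr_implies_not0 gr0I)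
  then have "w \<in> nbhd (petersen m k) (V i) \<longleftrightarrow>
      w \<in> {V ((i + k) mod m), V ((i + (m - k)) mod m), U i}" for w
    using assms unfolding nbhd_def
    by (cases w) (simp_all add: verts_petersen_iff petersen_edge_iff, blast+)
  then show ?thesis
    by blast
qed

lemma card_nbhd_petersen:
  assumes "m \<ge> 3" "0 < k" "k < m" "2 * k \<noteq> m" "u \<in> verts (petersen m k)"
  shows "card (nbhd (petersen m k) u) = 3"
proof -
  obtain i where "i < m" "u = U i \<or> u = V i"
    using petersen_vertexE[OF assms(5)] .
  then show ?thesis
    \<comment> \<open>Shift 1 handles the outer cycle, where \<open>m \<ge> 3\<close> excludes
      \<open>2 * 1 = m\<close>; shift \<open>k\<close> handles the inner edges.\<close>
    using assms add_mod_neq_sub_mod[of i m 1] add_mod_neq_sub_mod[of i m k]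
    by (auto simp: nbhd_petersen_U nbhd_petersen_V)
qed

section \<open>Upper bound by the parity labelling\<close>

fun alt_label :: "pvertex \<Rightarrow> int" where
  "alt_label (U i) = (if even i then 2 else -1)"
| "alt_label (V i) = (if even i then 2 else -1)"

text \<open>A vertex shares its label with its spoke partner, while its other two neighbours carry
  the opposite label, so every closed neighbourhood sums to 2 + 2 - 1 - 1 = 2. At a vertex labelled
  -1 those two are distinct and labelled 2. Label 1 never occurs.\<close>

lemma sdrdf_alt_label:
  assumes "m \<ge> 3" "even m" "0 < k" "k < m" "odd k" "2 * k \<noteq> m"
  shows "sdrdf (petersen m k) alt_label"
proof -
  let ?G = "petersen m k"
  have conds: "(alt_label u = -1 \<longrightarrow>
        (\<exists>w\<in>nbhd ?G u. \<exists>w'\<in>nbhd ?G u. w \<noteq> w' \<and> alt_label w = 2 \<and> alt_label w' = 2)) \<and>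
      sum alt_label (closed_nbhd ?G u) = 2" if uV: "u \<in> verts ?G" for u
  proof -
    obtain i where i: "i < m" and u: "u = U i \<or> u = V i"
      using petersen_vertexE[OF uV] .
    \<comment> \<open>Reduction modulo the even \<open>m\<close> preserves parity, and
      \<open>m - j\<close> is odd along with \<open>j\<close>. Stated for any odd shift to serve
      both \<open>j = 1\<close> and \<open>j = k\<close>.\<close>
    have par: "even ((i + j) mod m) \<longleftrightarrow> \<not> even i" "even ((i + (m - j)) mod m) \<longleftrightarrow> \<not> even i"
      "(i + j) mod m \<noteq> i" "(i + (m - j)) mod m \<noteq> i" "(i + j) mod m \<noteq> (i + (m - j)) mod m"
      if "odd j" "j < m" "2 * j \<noteq> m" for j
    proof -
      have "0 < j"
        using that(1) by (rule odd_pos)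
      show "even ((i + j) mod m) \<longleftrightarrow> \<not> even i" "even ((i + (m - j)) mod m) \<longleftrightarrow> \<not> even i"
        using that assms(2) by (simp_all add: dvd_mod_iff)
      show "(i + j) mod m \<noteq> i" "(i + (m - j)) mod m \<noteq> i"
        using mod_shift_neq[OF i, of j] mod_shift_neq[OF i, of "m - j"] \<open>0 < j\<close> that(2) by simp_all
      show "(i + j) mod m \<noteq> (i + (m - j)) mod m"
        using add_mod_neq_sub_mod[OF i \<open>0 < j\<close> that(2,3)] .
    qed
    note p1 = par[of 1] and pk = par[of k]
    from u show ?thesis
    proof
      assume u: "u = U i"
      have nb: "nbhd ?G u = {U ((i + 1) mod m), U ((i + (m - 1)) mod m), V i}"
        using assms i u by (simp add: nbhd_petersen_U)
      show ?thesis
        unfolding closed_nbhd_def nb using p1 assms by (auto simp: u)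
    next
      assume u: "u = V i"
      have nb: "nbhd ?G u = {V ((i + k) mod m), V ((i + (m - k)) mod m), U i}"
        using assms i u by (simp add: nbhd_petersen_V)
      show ?thesis
        unfolding closed_nbhd_def nb using pk assms by (auto simp: u)
    qed
  qed
  have vals: "alt_label u \<in> {-1, 2}" for u
    by (cases u) auto
  show ?thesis
    unfolding sdrdf_def using conds vals by (fastforce simp del: alt_label.simps)
qed

lemma sum_verts_petersen:
  "sum f (verts (petersen m k)) = (\<Sum>i<m. f (U i)) + (\<Sum>i<m. f (V i))"
proof -
  have "sum f (verts (petersen m k)) = sum f (U ` {0..<m}) + sum f (V ` {0..<m})"
    unfolding verts_petersen by (rule sum.union_disjoint) auto
  then show ?thesis
    by (simp add: sum.reindex inj_on_def atLeast0LessThan)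
qed

lemma sum_alternating: "(\<Sum>i<2 * n. if even i then 2 else -1 :: int) = int n"
  by (induction n) auto

lemma weight_alt_label:
  assumes "even m"
  shows "sum alt_label (verts (petersen m k)) = int m"
proof -
  obtain n where "m = 2 * n"
    using assms by blast
  then show ?thesis
    by (simp add: sum_verts_petersen sum_alternating)
qed

lemma card_verts_petersen: "card (verts (petersen m k)) = 2 * m"
  unfolding verts_petersen by (subst card_Un_disjoint) (auto simp: card_image inj_on_def)

text \<open>The condition \<open>2 * k \<noteq> m\<close> makes the graph cubic, which the lower
  bound needs, and gives each odd inner vertex two distinct neighbours labelled 2, which the upper
  bound needs.\<close>

theorem theorem4:
  fixes m k :: nat
  assumes "m \<ge> 4" and "even m"
    and "k \<in> {1..m - 1}" and "odd k"
    and "2 * k \<noteq> m"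
  shows "gamma_sdR (petersen m k) = int m"
  unfolding gamma_sdR_def
proof (rule Min_eqI)
  have mk: "m \<ge> 3" "0 < k" "k < m"
    using assms by auto
  note simple = simple_graph_petersen[OF mk]
  show "finite (sdrdf_weights (petersen m k))"
    using simple by (simp add: finite_sdrdf_weights simple_graph_def)
  show "int m \<in> sdrdf_weights (petersen m k)"
    using sdrdf_alt_label[OF mk(1) assms(2) mk(2,3) assms(4,5)] weight_alt_label[OF assms(2), of k]
    unfolding sdrdf_weights_def by force
  \<comment> \<open>With \<open>2 * m\<close> vertices, the cubic bound reads
    \<open>2 * x \<ge> 2 * m\<close>.\<close>
  show "int m \<le> x" if "x \<in> sdrdf_weights (petersen m k)" for x
    using that sdrdf_weight_cubic_ge[OF simple card_nbhd_petersen[OF mk assms(5)]]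
    by (auto simp: sdrdf_weights_def card_verts_petersen)
qed

end
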